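(* Let $A=\sigma(R)\langle x_1,\dots,x_n\rangle$ be a skew PBW extension of a ring $R$, with associated families $\Sigma=\{\sigma_1,\dots,\sigma_n\}$ and $\Delta=\{\delta_1,\dots,\delta_n\}$, and assume that the elements $c_{i,j}$ (with $x_jx_i-c_{i,j}x_ix_j\in R+Rx_1+\cdots+Rx_n$) are central in $R$. If $R$ is $\Sigma$-compatible and $(\Sigma,\Delta)$-skew Armendariz, then $R$ is skew $\Pi$-Armendariz (with respect to $A$).
   Context: Rings are associative with unity, not necessarily commutative; $\mathrm{nil}(B)$ is the set of nilpotent elements of a ring $B$. Skew PBW extension ($\sigma$-PBW extension): $A=\sigma(R)\langle x_1,\dots,x_n\rangle$ is a skew PBW extension of $R$ if (i) $R\subseteq A$ is a subring; (ii) there are $x_1,\dots,x_n\in A$ such that $A$ is a free left $R$-module with basis $\mathrm{Mon}(A)=\{x^\alpha=x_1^{\alpha_1}\cdots x_n^{\alpha_n}\mid \alpha\in\mathbb N^n\}$, with $x_1^0\cdots x_n^0=1$; (iii) for each $1\le i\le n$ and $r\in R\setminus\{0\}$ there is $c_{i,r}\in R\setminus\{0\}$ with $x_ir-c_{i,r}x_i\in R$; (iv) for all $1\le i,j\le n$ there is $c_{i,j}\in R\setminus\{0\}$ with $x_jx_i-c_{i,j}x_ix_j\in R+Rx_1+\cdots+Rx_n$. It is known that for each $i$ there are an injective ring endomorphism $\sigma_i:R\to R$ and a $\sigma_i$-derivation $\delta_i:R\to R$ (additive, $\delta_i(rs)=\sigma_i(r)\delta_i(s)+\delta_i(r)s$)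 with $x_ir=\sigma_i(r)x_i+\delta_i(r)$ for all $r\in R$; $\Sigma=\{\sigma_1,\dots,\sigma_n\}$ and $\Delta=\{\delta_1,\dots,\delta_n\}$ are these families. For $\alpha\in\mathbb N^n$, $\sigma^\alpha=\sigma_1^{\alpha_1}\cdots\sigma_n^{\alpha_n}$ (composition). $R$ is $\Sigma$-compatible if for all $a,b\in R$ and all $\alpha\in\mathbb N^n$: $a\sigma^\alpha(b)=0\iff ab=0$. Elements of $A$ are written $f=\sum_{i=0}^m a_iX_i$ with $a_i\in R$, $X_0=1$, and $X_0,X_1,\dots,X_m$ distinct elements of $\mathrm{Mon}(A)$. $(\Sigma,\Delta)$-skew Armendariz: $R$ is $(\Sigma,\Delta)$-skew Armendariz if for all $f=\sum_{i=0}^m a_iX_i$, $g=\sum_{j=0}^t b_jY_j$ in $A$ with $fg=0$, one has $a_iX_ib_jY_j=0$ (product in $A$) for all $i,j$. Skew $\Pi$-Armendariz: $R$ is skew $\Pi$-Armendariz (with respect to $A$) if for all $f=\sum_{i=0}^m a_iX_i$ and $g=\sum_{j=0}^t b_jY_j$ in $A$, $fg\in\mathrm{nil}(A)$ implies $a_ib_j\in\mathrm{nil}(R)$ for all $0\le i\le m$, $0\le j\le t$. *)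

theory Defs
  imports Main
begin

text \<open>
  The sort \<open>{ring, monoid_mult}\<close> is that of associative unital rings, not necessarily
  commutative; unlike \<open>ring_1\<close> it does not exclude the zero ring.  The extension \<open>A\<close> is
  the whole type \<open>'a\<close>, and the coefficient ring is a subset \<open>R\<close> of it.  The variables
  \<open>x\<^sub>1, \<dots>, x\<^sub>n\<close> and the families indexed by them are numbered from \<open>0\<close> to \<open>n - 1\<close>.
\<close>

definition is_subring :: "'a::{ring, monoid_mult} set \<Rightarrow> bool" where
  "is_subring R \<longleftrightarrow> 1 \<in> R \<and> (\<forall>a\<in>R. \<forall>b\<in>R. a - b \<in> R \<and> a * b \<in> R)"

definition nil :: "'a::{ring, monoid_mult} set \<Rightarrow> 'a set" where
  "nil B = {a \<in> B. \<exists>k\<ge>1. a ^ k = 0}"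


subsection \<open>Skew PBW extensions\<close>

text \<open>An exponent \<open>\<alpha> \<in> \<nat>\<^sup>n\<close> is a function on \<open>nat\<close> that vanishes from \<open>n\<close> on.\<close>

definition exponents :: "nat \<Rightarrow> (nat \<Rightarrow> nat) set" where
  "exponents n = {\<alpha>. \<forall>i\<ge>n. \<alpha> i = 0}"

definition monomial :: "nat \<Rightarrow> (nat \<Rightarrow> 'a::{ring, monoid_mult}) \<Rightarrow> (nat \<Rightarrow> nat) \<Rightarrow> 'a" where
  "monomial n x \<alpha> = prod_list (map (\<lambda>i. x i ^ \<alpha> i) [0..<n])"

definition Mon :: "nat \<Rightarrow> (nat \<Rightarrow> 'a::{ring, monoid_mult}) \<Rightarrow> 'a set" where
  "Mon n x = monomial n x ` exponents n"

definition left_basis ::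
    "'a::{ring, monoid_mult} set \<Rightarrow> 'a set \<Rightarrow> bool" where
  "left_basis R B \<longleftrightarrow>
     (\<forall>f. \<exists>S c. finite S \<and> S \<subseteq> B \<and> (\<forall>X\<in>S. c X \<in> R) \<and> f = (\<Sum>X\<in>S. c X * X)) \<and>
     (\<forall>S c. finite S \<longrightarrow> S \<subseteq> B \<longrightarrow> (\<forall>X\<in>S. c X \<in> R) \<longrightarrow> (\<Sum>X\<in>S. c X * X) = 0 \<longrightarrow>
        (\<forall>X\<in>S. c X = 0))"

definition linear_part :: "'a::{ring, monoid_mult} set \<Rightarrow> nat \<Rightarrow> (nat \<Rightarrow> 'a) \<Rightarrow> 'a set" where
  "linear_part R n x = {r + (\<Sum>i<n. s i * x i) | r s. r \<in> R \<and> (\<forall>i<n. s i \<in> R)}"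

definition structure_constants ::
    "'a::{ring, monoid_mult} set \<Rightarrow> nat \<Rightarrow> (nat \<Rightarrow> 'a) \<Rightarrow> (nat \<Rightarrow> nat \<Rightarrow> 'a) \<Rightarrow> bool" where
  "structure_constants R n x c \<longleftrightarrow>
     (\<forall>i<n. \<forall>j<n. c i j \<in> R - {0} \<and> x j * x i - c i j * x i * x j \<in> linear_part R n x)"

text \<open>
  That \<open>Mon n x\<close> is a basis is understood for the family \<open>(x\<^sup>\<alpha>)\<close> indexed by exponents, so
  distinct exponents give distinct monomials.  Without the injectivity clause, degenerate
  variables such as \<open>x\<^sub>1 = x\<^sub>2\<close> would be admitted.
\<close>

definition skew_PBW_extension ::
    "'a::{ring, monoid_mult} set \<Rightarrow> nat \<Rightarrow> (nat \<Rightarrow> 'a) \<Rightarrow> bool" where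
  "skew_PBW_extension R n x \<longleftrightarrow>
     is_subring R \<and>
     left_basis R (Mon n x) \<and> inj_on (monomial n x) (exponents n) \<and>
     (\<forall>i<n. \<forall>r\<in>R - {0}. \<exists>c\<in>R - {0}. x i * r - c * x i \<in> R) \<and>
     (\<exists>c. structure_constants R n x c)"


subsection \<open>The associated families and compatibility\<close>

text \<open>Maps \<open>R \<rightarrow> R\<close> are functions on the whole type, of which only the values on \<open>R\<close> matter.\<close>

definition ring_endomorphism :: "'a::{ring, monoid_mult} set \<Rightarrow> ('a \<Rightarrow> 'a) \<Rightarrow> bool" where
  "ring_endomorphism R s \<longleftrightarrow>
     s ` R \<subseteq> R \<and> s 1 = 1 \<and>
     (\<forall>a\<in>R. \<forall>b\<in>R. s (a + b) = s a + s b \<and> s (a * b) = s a * s b)"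

definition skew_derivation ::
    "'a::{ring, monoid_mult} set \<Rightarrow> ('a \<Rightarrow> 'a) \<Rightarrow> ('a \<Rightarrow> 'a) \<Rightarrow> bool" where
  "skew_derivation R s d \<longleftrightarrow>
     d ` R \<subseteq> R \<and>
     (\<forall>a\<in>R. \<forall>b\<in>R. d (a + b) = d a + d b \<and> d (a * b) = s a * d b + d a * b)"

text \<open>
  In a skew PBW extension the last clause determines \<open>\<sigma> i\<close> and \<open>\<delta> i\<close> on \<open>R\<close>, because \<open>1\<close> and
  \<open>x i\<close> are distinct elements of a basis.
\<close>

definition associated_families ::
    "'a::{ring, monoid_mult} set \<Rightarrow> nat \<Rightarrow> (nat \<Rightarrow> 'a) \<Rightarrow>
     (nat \<Rightarrow> 'a \<Rightarrow> 'a) \<Rightarrow> (nat \<Rightarrow> 'a \<Rightarrow> 'a) \<Rightarrow> bool" where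
  "associated_families R n x \<sigma> \<delta> \<longleftrightarrow>
     (\<forall>i<n. ring_endomorphism R (\<sigma> i) \<and> inj_on (\<sigma> i) R \<and> skew_derivation R (\<sigma> i) (\<delta> i) \<and>
        (\<forall>r\<in>R. x i * r = \<sigma> i r * x i + \<delta> i r))"

text \<open>Composition is in the order of the variables, so the last endomorphism is applied first.\<close>

definition sigma_power :: "nat \<Rightarrow> (nat \<Rightarrow> 'a \<Rightarrow> 'a) \<Rightarrow> (nat \<Rightarrow> nat) \<Rightarrow> 'a \<Rightarrow> 'a" where
  "sigma_power n \<sigma> \<alpha> = foldr (\<lambda>i f. (\<sigma> i ^^ \<alpha> i) \<circ> f) [0..<n] id"

definition Sigma_compatible ::
    "'a::{ring, monoid_mult} set \<Rightarrow> nat \<Rightarrow> (nat \<Rightarrow> 'a \<Rightarrow> 'a) \<Rightarrow> bool" where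
  "Sigma_compatible R n \<sigma> \<longleftrightarrow>
     (\<forall>a\<in>R. \<forall>b\<in>R. \<forall>\<alpha>\<in>exponents n. a * sigma_power n \<sigma> \<alpha> b = 0 \<longleftrightarrow> a * b = 0)"


subsection \<open>Armendariz conditions\<close>

text \<open>
  \<open>expansion R n x m a X f\<close> says that \<open>f = a\<^sub>0X\<^sub>0 + \<dots> + a\<^sub>mX\<^sub>m\<close> with coefficients in \<open>R\<close>
  (possibly zero), \<open>X\<^sub>0 = 1\<close>, and distinct monomials \<open>X\<^sub>0, \<dots>, X\<^sub>m\<close>.
\<close>

definition expansion ::
    "'a::{ring, monoid_mult} set \<Rightarrow> nat \<Rightarrow> (nat \<Rightarrow> 'a) \<Rightarrow>
     nat \<Rightarrow> (nat \<Rightarrow> 'a) \<Rightarrow> (nat \<Rightarrow> 'a) \<Rightarrow> 'a \<Rightarrow> bool" where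
  "expansion R n x m a X f \<longleftrightarrow>
     (\<forall>i\<le>m. a i \<in> R \<and> X i \<in> Mon n x) \<and> X 0 = 1 \<and> inj_on X {..m} \<and>
     f = (\<Sum>i\<le>m. a i * X i)"

text \<open>
  \<open>\<Sigma>\<close> and \<open>\<Delta>\<close> enter the next condition only through the multiplication of the extension.
\<close>

definition Sigma_Delta_skew_Armendariz ::
    "'a::{ring, monoid_mult} set \<Rightarrow> nat \<Rightarrow> (nat \<Rightarrow> 'a) \<Rightarrow> bool" where
  "Sigma_Delta_skew_Armendariz R n x \<longleftrightarrow>
     (\<forall>f g m a X t b Y. expansion R n x m a X f \<longrightarrow> expansion R n x t b Y g \<longrightarrow> f * g = 0 \<longrightarrow>
        (\<forall>i\<le>m. \<forall>j\<le>t. a i * X i * b j * Y j = 0))"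

definition skew_Pi_Armendariz ::
    "'a::{ring, monoid_mult} set \<Rightarrow> nat \<Rightarrow> (nat \<Rightarrow> 'a) \<Rightarrow> bool" where
  "skew_Pi_Armendariz R n x \<longleftrightarrow>
     (\<forall>f g m a X t b Y. expansion R n x m a X f \<longrightarrow> expansion R n x t b Y g \<longrightarrow>
        f * g \<in> nil UNIV \<longrightarrow> (\<forall>i\<le>m. \<forall>j\<le>t. a i * b j \<in> nil R))"

end

theory Submission
  imports Defs
begin

text \<open>
  The key fact is that \<open>f * g = 0\<close> implies \<open>a * g = 0\<close> for every coefficient \<open>a\<close> of \<open>f\<close>.  Applied
  repeatedly to \<open>f * g * f * g \<cdots> = 0\<close> it replaces each factor by one of its coefficients and
  gives \<open>(a\<^sub>i * b\<^sub>j) ^ k = 0\<close>.  To prove it, one cancels the variables one at a time: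
  \<open>a * x\<^sub>i * g = 0\<close> implies \<open>a * g = 0\<close>.  No leading terms are needed, because the Armendariz
  condition itself splits every relation into its summands.  By compatibility the cancellation
  reduces to \<open>s * x\<^sub>i * x\<^sup>\<beta> = 0 \<Longrightarrow> s = 0\<close>, which is an induction on \<open>i\<close> and then on \<open>\<beta>\<close>: if
  \<open>x\<^sup>\<beta>\<close> starts with \<open>x\<^sub>j\<close>, \<open>j < i\<close>, one commutes \<open>x\<^sub>i\<close> past \<open>x\<^sub>j\<close>, keeps the quadratic summand
  \<open>s * c\<^sub>j\<^sub>i * x\<^sub>j * x\<^sub>i\<close>, cancels \<open>x\<^sub>j\<close>, and uses that \<open>c\<^sub>j\<^sub>i\<close> is a unit.
\<close>

section \<open>Monomials and their exponents\<close>

lemma monomial_zero [simp]: "monomial n x (\<lambda>_. 0) = 1"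
proof -
  have "prod_list (map (\<lambda>_. 1) xs) = (1 :: 'a)" for xs :: "nat list"
    by (induction xs) auto
  then show ?thesis by (simp add: monomial_def)
qed

text \<open>All factors before index \<open>i\<close> are \<open>1\<close>, so the extra
  \<open>x i\<close> appears at the far left of the ordered product.\<close>

lemma monomial_upd_Suc:
  assumes "i < n" "\<And>j. j < i \<Longrightarrow> \<alpha> j = 0"
  shows "monomial n x (\<alpha>(i := Suc (\<alpha> i))) = x i * monomial n x \<alpha>"
proof -
  have split: "[0..<n] = [0..<i] @ i # [Suc i..<n]"
    using \<open>i < n\<close> by (metis upt_add_eq_append upt_conv_Cons le_add_diff_inverse less_imp_le zero_le)
  have one: "prod_list (map (\<lambda>j. x j ^ \<beta> j) [0..<i]) = 1" if "\<And>j. j < i \<Longrightarrow> \<beta> j = 0" for \<beta>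
  proof -
    have "map (\<lambda>j. x j ^ \<beta> j) [0..<i] = map (\<lambda>j. x j ^ ((\<lambda>_. 0 :: nat) j)) [0..<i]"
      using that by simp
    then show ?thesis
      using monomial_zero[of i x] unfolding monomial_def by metis
  qed
  have tail: "map (\<lambda>j. x j ^ (\<alpha>(i := Suc (\<alpha> i))) j) [Suc i..<n] = map (\<lambda>j. x j ^ \<alpha> j) [Suc i..<n]"
    by simp
  show ?thesis
    unfolding monomial_def split map_append prod_list.append list.map tail
    using one[of \<alpha>] one[of "\<alpha>(i := Suc (\<alpha> i))"] assms(2) by (simp add: mult.assoc)
qed

lemma zero_in_exponents [simp]: "(\<lambda>_. 0) \<in> exponents n"
  by (simp add: exponents_def)

lemma exponents_upd [simp]: "i < n \<Longrightarrow> \<alpha> \<in> exponents n \<Longrightarrow> \<alpha>(i := k) \<in> exponents n"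
  by (simp add: exponents_def)

text \<open>Lowering an entry decreases the total degree. The first nonzero entry is the one
  lowered, so that by \<open>monomial_upd_Suc\<close> each step splits off the leftmost
  variable.\<close>

lemma exponents_induct [consumes 1, case_names zero upd]:
  assumes "\<alpha> \<in> exponents n"
    and zero: "P (\<lambda>_. 0)"
    and upd: "\<And>i \<alpha>. i < n \<Longrightarrow> \<alpha> \<in> exponents n \<Longrightarrow> (\<And>j. j < i \<Longrightarrow> \<alpha> j = 0) \<Longrightarrow> P \<alpha> \<Longrightarrow>
      P (\<alpha>(i := Suc (\<alpha> i)))"
  shows "P \<alpha>"
  using assms(1)
proof (induction "\<Sum>i<n. \<alpha> i" arbitrary: \<alpha> rule: less_induct)
  case less
  show ?case
  proof (cases "\<alpha> = (\<lambda>_. 0)")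
    case True
    then show ?thesis using zero by simp
  next
    case False
    then obtain k where "\<alpha> k \<noteq> 0" by auto
    define i where "i = (LEAST k. \<alpha> k \<noteq> 0)"
    have i: "\<alpha> i \<noteq> 0"
      unfolding i_def by (rule LeastI) (fact \<open>\<alpha> k \<noteq> 0\<close>)
    have min: "\<alpha> j = 0" if "j < i" for j
      using not_less_Least that unfolding i_def by blast
    have "i < n"
    proof (rule ccontr)
      assume "\<not> i < n"
      then show False using i less.prems by (simp add: exponents_def)
    qed
    define \<beta> where "\<beta> = \<alpha>(i := \<alpha> i - 1)"
    have "(\<Sum>j<n. \<beta> j) < (\<Sum>j<n. \<alpha> j)"
      by (rule sum_strict_mono_ex1) (use \<open>i < n\<close> i in \<open>auto simp: \<beta>_def\<close>)
    moreover have "\<beta> \<in> exponents n"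
      using less.prems \<open>i < n\<close> by (simp add: \<beta>_def)
    ultimately have "P (\<beta>(i := Suc (\<beta> i)))"
      using less.hyps[of \<beta>] upd[of i \<beta>] \<open>i < n\<close> min by (simp add: \<beta>_def)
    moreover have "\<beta>(i := Suc (\<beta> i)) = \<alpha>"
      using i by (simp add: \<beta>_def)
    ultimately show ?thesis by simp
  qed
qed

text \<open>Allows compatibility, stated for composites, to be applied to a single
  endomorphism.\<close>

lemma sigma_power_unit:
  assumes "i < n"
  shows "sigma_power n \<sigma> ((\<lambda>_. 0)(i := 1)) = \<sigma> i"
proof -
  define \<alpha> :: "nat \<Rightarrow> nat" where "\<alpha> = (\<lambda>_. 0)(i := 1)"
  have id: "foldr (\<lambda>j f. (\<sigma> j ^^ \<alpha> j) \<circ> f) js g = g"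
    if "i \<notin> set js" for js and g :: "'b \<Rightarrow> 'a"
    using that by (induction js) (auto simp: \<alpha>_def)
  have "[0..<n] = [0..<i] @ i # [Suc i..<n]"
    using \<open>i < n\<close> by (metis upt_add_eq_append upt_conv_Cons le_add_diff_inverse less_imp_le zero_le)
  then have "sigma_power n \<sigma> \<alpha> = (\<sigma> i ^^ \<alpha> i) \<circ> id"
    by (simp add: sigma_power_def id)
  then show ?thesis by (simp add: \<alpha>_def)
qed

section \<open>Basis monomials, linear parts and structure constants\<close>

locale Armendariz_PBW =
  fixes R :: "'a::{ring, monoid_mult} set"
    and n :: nat
    and x :: "nat \<Rightarrow> 'a"
    and c :: "nat \<Rightarrow> nat \<Rightarrow> 'a"
    and \<sigma> \<delta> :: "nat \<Rightarrow> 'a \<Rightarrow> 'a"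
  assumes PBW: "skew_PBW_extension R n x"
    and families: "associated_families R n x \<sigma> \<delta>"
    and constants: "structure_constants R n x c"
    and central: "i < n \<Longrightarrow> j < n \<Longrightarrow> r \<in> R \<Longrightarrow> c i j * r = r * c i j"
    and compatible: "Sigma_compatible R n \<sigma>"
    and Armendariz: "Sigma_Delta_skew_Armendariz R n x"
begin

lemma one_in [simp]: "1 \<in> R"
  and diff_in [simp]: "a \<in> R \<Longrightarrow> b \<in> R \<Longrightarrow> a - b \<in> R"
  and mult_in [simp]: "a \<in> R \<Longrightarrow> b \<in> R \<Longrightarrow> a * b \<in> R"
  using PBW by (auto simp: skew_PBW_extension_def is_subring_def)

lemma zero_in [simp]: "0 \<in> R"
  using diff_in[OF one_in one_in] by simp

lemma uminus_in [simp]: "a \<in> R \<Longrightarrow> - a \<in> R"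
  using diff_in[OF zero_in] by simp

lemma add_in [simp]: "a \<in> R \<Longrightarrow> b \<in> R \<Longrightarrow> a + b \<in> R"
  using diff_in[of a "- b"] by simp

lemma const_in [simp]: "i < n \<Longrightarrow> j < n \<Longrightarrow> c i j \<in> R"
  using constants by (simp add: structure_constants_def)

lemma Mon_expansion:
  obtains S d where "finite S" "S \<subseteq> Mon n x" "\<forall>X\<in>S. d X \<in> R" "f = (\<Sum>X\<in>S. d X * X)"
  using PBW unfolding skew_PBW_extension_def left_basis_def by metis

lemma Mon_independent:
  assumes "finite S" "S \<subseteq> Mon n x" "\<forall>X\<in>S. d X \<in> R" "(\<Sum>X\<in>S. d X * X) = 0" "X \<in> S"
  shows "d X = 0"
  using PBW assms unfolding skew_PBW_extension_def left_basis_def by blast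

lemma Mon_cancel:
  assumes "s \<in> R" "X \<in> Mon n x" "s * X = 0"
  shows "s = 0"
  using Mon_independent[of "{X}" "\<lambda>_. s" X] assms by simp

lemma monomial_in_Mon [simp]: "\<alpha> \<in> exponents n \<Longrightarrow> monomial n x \<alpha> \<in> Mon n x"
  by (simp add: Mon_def)

lemma one_in_Mon [simp]: "1 \<in> Mon n x"
  using monomial_in_Mon[of "\<lambda>_. 0"] by simp

lemma monomial_eq_iff:
  "\<alpha> \<in> exponents n \<Longrightarrow> \<beta> \<in> exponents n \<Longrightarrow> monomial n x \<alpha> = monomial n x \<beta> \<longleftrightarrow> \<alpha> = \<beta>"
  using PBW by (auto simp: skew_PBW_extension_def dest: inj_onD)

lemma var_eq_monomial: "i < n \<Longrightarrow> x i = monomial n x ((\<lambda>_. 0)(i := 1))"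
  using monomial_upd_Suc[of i n "\<lambda>_. 0" x] by simp

lemma var_mult_eq_monomial:
  "j < i \<Longrightarrow> i < n \<Longrightarrow> x j * x i = monomial n x ((\<lambda>_. 0)(i := 1, j := 1))"
  using monomial_upd_Suc[of j n "(\<lambda>_. 0)(i := 1)" x] by (simp add: var_eq_monomial)

lemma var_in_Mon [simp]: "i < n \<Longrightarrow> x i \<in> Mon n x"
  by (simp add: var_eq_monomial)

lemma var_mult_in_Mon [simp]: "j < i \<Longrightarrow> i < n \<Longrightarrow> x j * x i \<in> Mon n x"
  by (simp add: var_mult_eq_monomial)

lemma var_neq_one: "i < n \<Longrightarrow> x i \<noteq> 1"
  using monomial_eq_iff[of "(\<lambda>_. 0)(i := 1)" "\<lambda>_. 0"]
  by (auto simp: var_eq_monomial fun_eq_iff)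

lemma inj_var: "inj_on x {..<n}"
  by (rule inj_onI) (auto simp: var_eq_monomial monomial_eq_iff fun_eq_iff split: if_splits)

text \<open>For \<open>j < i\<close> the product \<open>x j * x i\<close> is a basis monomial of
  degree two. Its separation from the linear monomials lets its coefficient be isolated.\<close>

lemma var_mult_notin_linear:
  assumes "j < i" "i < n"
  shows "x j * x i \<notin> insert 1 (x ` {..<n})"
proof -
  let ?\<alpha> = "(\<lambda>_. 0)(i := 1, j := 1) :: nat \<Rightarrow> nat"
  have "?\<alpha> \<noteq> (\<lambda>_. 0)" "\<And>k. ?\<alpha> \<noteq> (\<lambda>_. 0)(k := 1)"
    using assms by (auto simp: fun_eq_iff)
  moreover have "?\<alpha> \<in> exponents n" using assms by simp
  ultimately have "monomial n x ?\<alpha> \<noteq> 1" "\<And>k. k < n \<Longrightarrow> monomial n x ?\<alpha> \<noteq> x k"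
    using monomial_eq_iff[of ?\<alpha> "\<lambda>_. 0"] monomial_eq_iff[of ?\<alpha>] var_eq_monomial by simp_all
  then show ?thesis
    unfolding var_mult_eq_monomial[OF assms] by blast
qed

text \<open>Reindexes by monomials instead of variables, the form that
  \<open>Mon_independent\<close> and \<open>Armendariz_sum\<close> take.\<close>

lemma linear_part_expansion:
  assumes "l \<in> linear_part R n x"
  obtains d where "\<And>X. d X \<in> R" "l = (\<Sum>X\<in>insert 1 (x ` {..<n}). d X * X)"
proof -
  obtain r s where l: "l = r + (\<Sum>i<n. s i * x i)" "r \<in> R" "\<And>i. i < n \<Longrightarrow> s i \<in> R"
    using assms by (auto simp: linear_part_def)
  \<comment> \<open>The index is recovered from the variable by injectivity; the default
    \<open>0\<close> keeps every \<open>d X\<close> in \<open>R\<close>.\<close>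
  define d where "d X = (if X = 1 then r else if X \<in> x ` {..<n} then s (inv_into {..<n} x X) else 0)"
    for X
  have "1 \<notin> x ` {..<n}"
    using var_neq_one by force
  then have "(\<Sum>X\<in>insert 1 (x ` {..<n}). d X * X) = r + (\<Sum>X\<in>x ` {..<n}. d X * X)"
    by (simp add: d_def)
  also have "(\<Sum>X\<in>x ` {..<n}. d X * X) = (\<Sum>i<n. d (x i) * x i)"
    by (simp add: sum.reindex inj_var)
  also have "\<dots> = (\<Sum>i<n. s i * x i)"
    by (rule sum.cong) (auto simp: d_def var_neq_one inv_into_f_f[OF inj_var])
  finally have "l = (\<Sum>X\<in>insert 1 (x ` {..<n}). d X * X)"
    using l by simp
  moreover have "d X \<in> R" for X
    using l by (auto simp: d_def inv_into_f_f[OF inj_var])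
  ultimately show ?thesis using that by blast
qed

lemma var_commute:
  assumes "i < n" "j < n"
  obtains l where "l \<in> linear_part R n x" "x j * x i = c i j * x i * x j + l"
proof
  show "x j * x i - c i j * x i * x j \<in> linear_part R n x"
    using constants assms by (simp add: structure_constants_def)
qed simp

text \<open>Rewriting \<open>x\<^sub>j * x\<^sub>i\<close> twice and comparing the coefficients of the monomial \<open>x\<^sub>j * x\<^sub>i\<close>.\<close>

lemma const_unit:
  assumes "j < i" "i < n"
  shows "c i j * c j i = 1"
proof -
  let ?m = "x j * x i" and ?L = "insert 1 (x ` {..<n})"
  have jn: "j < n" using assms by simp
  obtain l where l: "l \<in> linear_part R n x" "x j * x i = c i j * x i * x j + l"
    using var_commute[of i j] assms jn by blast
  obtain l' where l': "l' \<in> linear_part R n x" "x i * x j = c j i * x j * x i + l'"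
    using var_commute[of j i] assms jn by blast
  obtain d where d: "\<And>X. d X \<in> R" "l = (\<Sum>X\<in>?L. d X * X)"
    using linear_part_expansion[OF l(1)] by blast
  obtain d' where d': "\<And>X. d' X \<in> R" "l' = (\<Sum>X\<in>?L. d' X * X)"
    using linear_part_expansion[OF l'(1)] by blast
  \<comment> \<open>The coefficients of the relation obtained by substituting one commutation rule
    into the other and moving everything to one side.\<close>
  define e where "e X = (if X = ?m then 1 - c i j * c j i else - (c i j * d' X) - d X)" for X
  have "?m = c i j * (x i * x j) + l"
    using l(2) by (simp add: mult.assoc)
  also have "\<dots> = c i j * (c j i * x j * x i + l') + l"
    by (simp only: l'(2))
  finally have "(1 - c i j * c j i) * ?m + (- (c i j * l') - l) = 0"
    by (simp add: algebra_simps)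
  also have "- (c i j * l') - l = (\<Sum>X\<in>?L. (- (c i j * d' X) - d X) * X)"
    unfolding d(2) d'(2)
    by (simp only: sum_distrib_left sum_negf[symmetric] sum_subtractf[symmetric]
        left_diff_distrib mult_minus_left mult.assoc)
  also have "\<dots> = (\<Sum>X\<in>?L. e X * X)"
    using var_mult_notin_linear[OF assms] by (intro sum.cong) (auto simp: e_def)
  finally have "(\<Sum>X\<in>insert ?m ?L. e X * X) = 0"
    by (subst sum.insert) (use var_mult_notin_linear[OF assms] in \<open>auto simp: e_def\<close>)
  then have "e ?m = 0"
    by (rule Mon_independent[rotated 3]) (use assms jn d d' in \<open>auto simp: e_def\<close>)
  then show ?thesis by (simp add: e_def)
qed

section \<open>The Armendariz condition for finite sums\<close>

text \<open>An \<open>expansion\<close> must start with the monomial \<open>1\<close>; if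
  \<open>S\<close> lacks it, it is added with coefficient \<open>0\<close>.\<close>

lemma expansion_of_sum:
  assumes "finite S" "S \<subseteq> Mon n x" "\<forall>X\<in>S. d X \<in> R"
  obtains m a Y where "expansion R n x m a Y (\<Sum>X\<in>S. d X * X)"
    "\<And>X. X \<in> S \<Longrightarrow> \<exists>i\<le>m. Y i = X \<and> a i = d X"
proof -
  \<comment> \<open>Index \<open>0\<close> is reserved for the monomial \<open>1\<close>, so the
    others are enumerated separately and shifted by one.\<close>
  define T where "T = S - {1}"
  have "finite T" using assms by (simp add: T_def)
  then obtain h where h: "bij_betw h {0..<card T} T"
    using ex_bij_betw_nat_finite by blast
  define Y where "Y i = (if i = 0 then 1 else h (i - 1))" for i
  define e where "e X = (if X \<in> S then d X else 0)" for X
  have h_in: "h i \<in> T" if "i < card T" for i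
    using h that by (auto simp: bij_betw_def)
  have inj: "inj_on Y {..card T}"
  proof (rule inj_onI)
    fix i j assume ij: "i \<in> {..card T}" "j \<in> {..card T}" "Y i = Y j"
    consider "i = 0" "j = 0" | "i = 0" "j > 0" | "i > 0" "j = 0" | "i > 0" "j > 0" by blast
    then show "i = j"
    proof cases
      case 2
      then have "h (j - 1) \<in> T" using ij by (intro h_in) auto
      then show ?thesis using 2 ij by (auto simp: Y_def T_def)
    next
      case 3
      then have "h (i - 1) \<in> T" using ij by (intro h_in) auto
      then show ?thesis using 3 ij by (auto simp: Y_def T_def)
    next
      case 4
      then have "i - 1 = j - 1"
        using ij h by (intro inj_onD[of h "{0..<card T}"]) (auto simp: Y_def bij_betw_def)
      then show ?thesis using 4 by simp
    qed simp
  qed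
  have range: "Y ` {..card T} = insert 1 S"
  proof -
    have "{..card T} = insert 0 (Suc ` {0..<card T})"
      by (simp add: image_Suc_atLeastLessThan atMost_atLeast0 atLeastLessThanSuc_atLeastAtMost
          atLeast0_atMost_Suc atLeastAtMost_insertL)
    then have "Y ` {..card T} = insert (Y 0) ((Y \<circ> Suc) ` {0..<card T})"
      by (simp only: image_insert image_comp)
    moreover have "Y \<circ> Suc = h" "Y 0 = 1" by (auto simp: Y_def)
    ultimately have "Y ` {..card T} = insert 1 (h ` {0..<card T})" by simp
    then show ?thesis using h by (auto simp: bij_betw_def T_def)
  qed
  have "(\<Sum>i\<le>card T. e (Y i) * Y i) = (\<Sum>X\<in>insert 1 S. e X * X)"
    unfolding range[symmetric] by (simp add: sum.reindex[OF inj])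
  also have "\<dots> = (\<Sum>X\<in>S. d X * X)"
    by (rule sum.mono_neutral_cong_right) (use assms in \<open>auto simp: e_def\<close>)
  finally have sum: "(\<Sum>X\<in>S. d X * X) = (\<Sum>i\<le>card T. e (Y i) * Y i)" by simp
  have "Y i \<in> Mon n x" if "i \<le> card T" for i
  proof -
    have "Y i \<in> insert 1 S" using that unfolding range[symmetric] by simp
    then show ?thesis using assms(2) by auto
  qed
  then have "expansion R n x (card T) (e \<circ> Y) Y (\<Sum>X\<in>S. d X * X)"
    unfolding expansion_def using inj sum assms by (auto simp: Y_def e_def)
  moreover have "\<exists>i\<le>card T. Y i = X \<and> (e \<circ> Y) i = d X" if "X \<in> S" for X
  proof -
    have "X \<in> Y ` {..card T}" using range that by blast
    then show ?thesis using that by (auto simp: e_def)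
  qed
  ultimately show ?thesis using that by blast
qed

lemma Armendariz_sum:
  assumes "finite S" "S \<subseteq> Mon n x" "\<forall>X\<in>S. a X \<in> R"
    and "finite T" "T \<subseteq> Mon n x" "\<forall>Y\<in>T. b Y \<in> R"
    and "(\<Sum>X\<in>S. a X * X) * (\<Sum>Y\<in>T. b Y * Y) = 0" "X \<in> S" "Y \<in> T"
  shows "a X * X * b Y * Y = 0"
proof -
  obtain m d U where U: "expansion R n x m d U (\<Sum>X\<in>S. a X * X)"
    "\<And>X. X \<in> S \<Longrightarrow> \<exists>i\<le>m. U i = X \<and> d i = a X"
    using expansion_of_sum[OF assms(1-3)] by blast
  obtain t e V where V: "expansion R n x t e V (\<Sum>Y\<in>T. b Y * Y)"
    "\<And>Y. Y \<in> T \<Longrightarrow> \<exists>i\<le>t. V i = Y \<and> e i = b Y"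
    using expansion_of_sum[OF assms(4-6)] by blast
  obtain i where i: "i \<le> m" "U i = X" "d i = a X" using U(2)[OF assms(8)] by blast
  obtain j where j: "j \<le> t" "V j = Y" "e j = b Y" using V(2)[OF assms(9)] by blast
  have "d i * U i * e j * V j = 0"
    using Armendariz U(1) V(1) assms(7) i(1) j(1)
    unfolding Sigma_Delta_skew_Armendariz_def by blast
  then show ?thesis by (simp add: i j)
qed

section \<open>Cancellation of variables and monomials\<close>

text \<open>Stated conditionally because the induction that proves the second hypothesis uses this
  lemma for smaller \<open>i\<close>.\<close>

lemma var_cancel_if:
  assumes "i < n" and mon: "\<And>s Y. s \<in> R \<Longrightarrow> Y \<in> Mon n x \<Longrightarrow> s * x i * Y = 0 \<Longrightarrow> s = 0"
    and "a \<in> R" "a * x i * g = 0"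
  shows "a * g = 0"
proof -
  obtain T b where T: "finite T" "T \<subseteq> Mon n x" "\<forall>Y\<in>T. b Y \<in> R" "g = (\<Sum>Y\<in>T. b Y * Y)"
    by (rule Mon_expansion)
  have \<sigma>: "\<sigma> i r \<in> R" "\<delta> i r \<in> R" "x i * r = \<sigma> i r * x i + \<delta> i r" if "r \<in> R" for r
    using families \<open>i < n\<close> that
    by (auto simp: associated_families_def ring_endomorphism_def skew_derivation_def image_subset_iff)
  have "a * b Y = 0" if Y: "Y \<in> T" for Y
  proof -
    have bY: "b Y \<in> R" using T Y by blast
    have "a * x i * b Y * Y = 0"
      using Armendariz_sum[of "{x i}" "\<lambda>_. a" T b "x i" Y] T assms Y by simp
    \<comment> \<open>Moving \<open>x i\<close> past \<open>b Y\<close> creates a derivation term.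
      Reading the left factor as a sum over \<open>x i\<close> and \<open>1\<close>, the Armendariz
      condition discards that term.\<close>
    then have "(a * \<sigma> i (b Y) * x i + a * \<delta> i (b Y)) * Y = 0"
      by (simp add: \<sigma>(3)[OF bY] mult.assoc distrib_left)
    then have "a * \<sigma> i (b Y) * x i * Y = 0"
      using Armendariz_sum[of "{x i, 1}" "\<lambda>X. if X = 1 then a * \<delta> i (b Y) else a * \<sigma> i (b Y)"
          "{Y}" "\<lambda>_. 1" "x i" Y] \<sigma>[OF bY] assms(1,3) var_neq_one T(2) Y by auto
    then have "a * \<sigma> i (b Y) = 0"
      using mon[of "a * \<sigma> i (b Y)" Y] \<sigma>[OF bY] assms(3) T(2) Y by auto
    then have "a * sigma_power n \<sigma> ((\<lambda>_. 0)(i := 1)) (b Y) = 0"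
      by (simp only: sigma_power_unit[OF \<open>i < n\<close>])
    moreover have "(\<lambda>_. 0)(i := 1) \<in> exponents n"
      using \<open>i < n\<close> by simp
    ultimately show ?thesis
      using compatible \<open>a \<in> R\<close> bY unfolding Sigma_compatible_def by blast
  qed
  then have "a * (b Y * Y) = 0" if "Y \<in> T" for Y
    using that by (simp add: mult.assoc[symmetric])
  then show ?thesis
    by (simp add: T(4) sum_distrib_left)
qed

text \<open>The outer hypothesis supplies what \<open>var_cancel_if\<close> requires for
  \<open>j < i\<close>; the inner one handles the shorter monomial. Both leave \<open>s\<close>
  arbitrary because it gets replaced by \<open>s * c j i\<close>.\<close>

lemma var_monomial_cancel:
  assumes "i < n" "\<beta> \<in> exponents n" "s \<in> R" "s * x i * monomial n x \<beta> = 0"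
  shows "s = 0"
  using assms
proof (induction i arbitrary: s \<beta> rule: less_induct)
  case (less i)
  from less.prems(2,3,4) show ?case
  proof (induction arbitrary: s rule: exponents_induct)
    case zero
    then show ?case using Mon_cancel[of s "x i"] less.prems(1) by simp
  next
    case (upd j \<beta>)
    let ?\<gamma> = "\<beta>(j := Suc (\<beta> j))"
    show ?case
    proof (cases "i \<le> j")
      case True
      \<comment> \<open>No variable before \<open>x i\<close> occurs in the monomial, so the product
        is again a basis monomial.\<close>
      then have "x i * monomial n x ?\<gamma> = monomial n x (?\<gamma>(i := Suc (?\<gamma> i)))"
        using upd.hyps less.prems(1) by (intro monomial_upd_Suc[symmetric]) auto
      moreover have "monomial n x (?\<gamma>(i := Suc (?\<gamma> i))) \<in> Mon n x"
        using upd.hyps less.prems(1) by (intro monomial_in_Mon exponents_upd)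
      ultimately show ?thesis
        using Mon_cancel upd.prems by (metis mult.assoc)
    next
      case False
      then have "j < i" by simp
      let ?m = "x j * x i" and ?L = "insert 1 (x ` {..<n})"
      obtain l where l: "l \<in> linear_part R n x" "x i * x j = c j i * x j * x i + l"
        using var_commute[of j i] upd.hyps(1) less.prems(1) by blast
      obtain d where d: "\<And>X. d X \<in> R" "l = (\<Sum>X\<in>?L. d X * X)"
        using linear_part_expansion[OF l(1)] by blast
      define e where "e X = (if X = ?m then s * c j i else s * d X)" for X
      have m: "?m \<notin> ?L"
        using var_mult_notin_linear \<open>j < i\<close> less.prems(1) by blast
      have "s * l = (\<Sum>X\<in>?L. e X * X)"
        unfolding d(2) sum_distrib_left using m
        by (intro sum.cong) (auto simp: e_def mult.assoc)
      then have e: "(\<Sum>X\<in>insert ?m ?L. e X * X) = s * (c j i * x j * x i + l)"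
        by (subst sum.insert) (use m in \<open>auto simp: e_def mult.assoc distrib_left\<close>)
      have "s * (x i * x j) * monomial n x \<beta> = 0"
        using upd.prems(2) upd.hyps
        by (simp add: monomial_upd_Suc mult.assoc del: fun_upd_apply)
      then have "(\<Sum>X\<in>insert ?m ?L. e X * X) * monomial n x \<beta> = 0"
        unfolding e l(2) .
      moreover have "(\<Sum>Y\<in>{monomial n x \<beta>}. 1 * Y) = monomial n x \<beta>"
        by simp
      ultimately have "(\<Sum>X\<in>insert ?m ?L. e X * X) * (\<Sum>Y\<in>{monomial n x \<beta>}. 1 * Y) = 0"
        by (simp only:)
      \<comment> \<open>The quadratic summand annihilates the monomial on its own.\<close>
      then have "e ?m * ?m * 1 * monomial n x \<beta> = 0"
        using upd.hyps upd.prems(1) less.prems(1) \<open>j < i\<close> d(1)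
        by (intro Armendariz_sum[of "insert ?m ?L" e "{monomial n x \<beta>}" "\<lambda>_. 1"])
          (auto simp: e_def)
      then have "s * c j i * x j * (x i * monomial n x \<beta>) = 0"
        by (simp add: e_def mult.assoc)
      then have "s * c j i * (x i * monomial n x \<beta>) = 0"
        using less.IH[OF \<open>j < i\<close> \<open>j < n\<close>] upd.prems(1) upd.hyps(1) less.prems(1)
        by (intro var_cancel_if[OF \<open>j < n\<close>, where a = "s * c j i"]) (auto simp: Mon_def)
      then have "s * c j i = 0"
        using upd.IH[of "s * c j i"] upd.prems(1) upd.hyps(1) less.prems(1)
        by (simp add: mult.assoc)
      \<comment> \<open>Centrality reverses the product in \<open>const_unit\<close>, giving a right
        inverse of \<open>c j i\<close>, which is what \<open>s * c j i = 0\<close> calls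
        for.\<close>
      moreover have "c j i * c i j = 1"
        using const_unit[OF \<open>j < i\<close> less.prems(1)] central[of i j "c j i"] upd.hyps(1) less.prems(1)
        by simp
      ultimately show ?thesis
        by (metis mult.assoc mult.right_neutral mult_zero_left)
    qed
  qed
qed

lemma var_cancel:
  assumes "i < n" "a \<in> R" "a * x i * g = 0"
  shows "a * g = 0"
  using var_cancel_if[OF assms(1) _ assms(2,3)] var_monomial_cancel[OF assms(1)]
  by (auto simp: Mon_def)

text \<open>The variables are cancelled from the left, the rest of the monomial being absorbed into
  \<open>g\<close>.\<close>

lemma monomial_cancel:
  assumes "X \<in> Mon n x" "a \<in> R" "a * X * g = 0"
  shows "a * g = 0"
proof -
  obtain \<alpha> where "\<alpha> \<in> exponents n" "X = monomial n x \<alpha>"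
    using assms(1) by (auto simp: Mon_def)
  moreover have "a * monomial n x \<alpha> * g = 0 \<Longrightarrow> a * g = 0" if "\<alpha> \<in> exponents n"
    using that
  proof (induction rule: exponents_induct)
    case (upd i \<alpha>)
    then have "a * x i * (monomial n x \<alpha> * g) = 0"
      by (simp add: monomial_upd_Suc mult.assoc del: fun_upd_apply)
    then show ?case
      using var_cancel[of i a "monomial n x \<alpha> * g"] upd assms(2) by (simp add: mult.assoc)
  qed simp
  ultimately show ?thesis using assms(3) by simp
qed

section \<open>From nilpotent products to nilpotent coefficients\<close>

text \<open>The Armendariz condition kills each term \<open>a i * X i * e j * V j\<close>;
  cancelling \<open>X i\<close> and summing over \<open>j\<close> restores \<open>g\<close>.\<close>

lemma coeff_annihilates:
  assumes "expansion R n x m a X f" "f * g = 0" "i \<le> m"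
  shows "a i * g = 0"
proof -
  obtain T b where T: "finite T" "T \<subseteq> Mon n x" "\<forall>Y\<in>T. b Y \<in> R" "g = (\<Sum>Y\<in>T. b Y * Y)"
    by (rule Mon_expansion)
  obtain t e V where V: "expansion R n x t e V g"
    using expansion_of_sum[OF T(1-3)] T(4) by metis
  have "a i * (e j * V j) = 0" if "j \<le> t" for j
  proof -
    have "a i * X i * e j * V j = 0"
      using Armendariz assms V that unfolding Sigma_Delta_skew_Armendariz_def by blast
    then show ?thesis
      using monomial_cancel[of "X i" "a i" "e j * V j"] assms
      by (simp add: expansion_def mult.assoc)
  qed
  moreover have "g = (\<Sum>j\<le>t. e j * V j)" using V by (simp add: expansion_def)
  ultimately show ?thesis by (simp add: sum_distrib_left)
qed

lemma expansion_scale: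
  assumes "expansion R n x m a X f" "r \<in> R"
  shows "expansion R n x m (\<lambda>i. r * a i) X (r * f)"
  using assms by (simp add: expansion_def sum_distrib_left mult.assoc)

text \<open>The left factor \<open>r\<close> collects the coefficients already extracted.
  \<open>expansion_scale\<close> absorbs it into the next factor, so that
  \<open>coeff_annihilates\<close> applies again.\<close>

lemma coeff_product_power:
  assumes f: "expansion R n x m a X f" and g: "expansion R n x t b Y g"
    and i: "i \<le> m" and j: "j \<le> t"
  shows "r \<in> R \<Longrightarrow> r * (f * g) ^ k = 0 \<Longrightarrow> r * (a i * b j) ^ k = 0"
proof (induction k arbitrary: r)
  case (Suc k)
  let ?h = "(f * g) ^ k"
  have ab: "a i \<in> R" "b j \<in> R" using f g i j by (auto simp: expansion_def)
  have "(r * f) * (g * ?h) = 0" using Suc.prems by (simp add: mult.assoc)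
  then have "(r * a i * g) * ?h = 0"
    using coeff_annihilates[OF expansion_scale[OF f \<open>r \<in> R\<close>] _ i] by (simp add: mult.assoc)
  then have "r * a i * b j * ?h = 0"
    using coeff_annihilates[OF expansion_scale[OF g] _ j] ab Suc.prems(1) by simp
  then show ?case
    using Suc.IH[of "r * a i * b j"] ab Suc.prems(1) by (simp add: mult.assoc)
qed simp

end

theorem proposition3p3:
  fixes R :: "'a::{ring, monoid_mult} set"
    and n :: nat
    and x :: "nat \<Rightarrow> 'a"
    and c :: "nat \<Rightarrow> nat \<Rightarrow> 'a"
    and \<sigma> \<delta> :: "nat \<Rightarrow> 'a \<Rightarrow> 'a"
  assumes "skew_PBW_extension R n x"
    and "associated_families R n x \<sigma> \<delta>"
    and "structure_constants R n x c"
    and "\<forall>i<n. \<forall>j<n. \<forall>r\<in>R. c i j * r = r * c i j"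
    and "Sigma_compatible R n \<sigma>"
    and "Sigma_Delta_skew_Armendariz R n x"
  shows "skew_Pi_Armendariz R n x"
proof -
  interpret Armendariz_PBW R n x c \<sigma> \<delta>
    using assms by unfold_locales auto
  show ?thesis
    unfolding skew_Pi_Armendariz_def
  proof (intro allI impI)
    fix f g :: 'a and m t i j and a X b Y :: "nat \<Rightarrow> 'a"
    assume f: "expansion R n x m a X f" and g: "expansion R n x t b Y g"
      and "f * g \<in> nil UNIV" and i: "i \<le> m" and j: "j \<le> t"
    then obtain k where "k \<ge> 1" "(f * g) ^ k = 0" by (auto simp: nil_def)
    \<comment> \<open>The extraction starts with \<open>r = 1\<close>.\<close>
    then have "(a i * b j) ^ k = 0"
      using coeff_product_power[OF f g i j one_in, of k] by simp
    moreover have "a i * b j \<in> R"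
      using f g i j by (simp add: expansion_def)
    ultimately show "a i * b j \<in> nil R"
      using \<open>k \<ge> 1\<close> by (auto simp: nil_def)
  qed
qed

end
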